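(* Let $X$ be a Tychonoff space that has a coarser separable metrizable topology. The following assertions are equivalent: (1) $C_p(X)$ is sequentially separable; (2) $C_p(X)$ is $\sigma$-separable; (3) $X$ has Velichko's property.
   Context: $C_p(X)$ denotes the set of all continuous real-valued functions on $X$ with the topology of pointwise convergence. "Countable" means at most countable. For a topological space $Z$ and $A\subseteq Z$, $[A]$ denotes the closure of $A$ in $Z$, and the sequential closure $[A]_s$ is the set of all limits in $Z$ of sequences of points of $A$. A space $Z$ is sequentially separable if there is a countable $A\subseteq Z$ with $Z=[A]_s$. The $\sigma$-closure $[A]_\sigma$ of a set $A\subseteq Z$ is the set of all points $x\in Z$ such that: (a) $x\in[A]_s$; and (b) whenever a sequence $\langle x_n\rangle_{n\in\mathbb N}$ of points of $A$ converges to $x$ and $x\in[A\setminus\{x_n:n\in\mathbb N\}]$, there exists a sequence $\langle y_n\rangle_{n\in\mathbb N}$ of points of $A\setminus\{x_n:n\in\mathbb N\}$ converging to $x$. A set $A$ is $\sigma$-dense in $Z$ if $Z=[A]_\sigma$. A space $Z$ is $\sigma$-separable if it contains a countable $\sigma$-dense set. A space $X$ has Velichko's property if there exists a continuous bijection $f:X\to Y$ from $X$ onto a separable metric space $Y$ such that $f(U)$ is an $F_\sigma$-set of $Y$ for every cozero-set $U$ of $X$. *)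

theory Defs
  imports "HOL-Analysis.Analysis"
begin

definition tychonoff_space :: "'a topology \<Rightarrow> bool" where
  "tychonoff_space X \<longleftrightarrow> completely_regular_space X \<and> t1_space X"

definition has_coarser_separable_metrizable :: "'a topology \<Rightarrow> bool" where
  "has_coarser_separable_metrizable X \<longleftrightarrow>
     (\<exists>T. topspace T = topspace X \<and> (\<forall>U. openin T U \<longrightarrow> openin X U)
        \<and> separable_space T \<and> metrizable_space T)"

text \<open>The points of the product topology are extensional functions (constantly \<^term>\<open>undefined\<close>
  off \<^term>\<open>topspace X\<close>), so each continuous function on \<^term>\<open>X\<close> is represented exactly once.\<close>

definition Cp :: "'a topology \<Rightarrow> ('a \<Rightarrow> real) topology" where
  "Cp X = subtopology (powertop_real (topspace X)) {f. continuous_map X euclideanreal f}"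

definition seq_closure_of :: "'a topology \<Rightarrow> 'a set \<Rightarrow> 'a set" (infixr \<open>seq'_closure'_of\<close> 80) where
  "Z seq_closure_of A = {x. \<exists>s :: nat \<Rightarrow> 'a. range s \<subseteq> A \<and> limitin Z s x sequentially}"

definition sequentially_separable_space :: "'a topology \<Rightarrow> bool" where
  "sequentially_separable_space Z \<longleftrightarrow>
     (\<exists>A. countable A \<and> A \<subseteq> topspace Z \<and> Z seq_closure_of A = topspace Z)"

definition sigma_closure_of :: "'a topology \<Rightarrow> 'a set \<Rightarrow> 'a set"
    (infixr \<open>sigma'_closure'_of\<close> 80) where
  "Z sigma_closure_of A = {x \<in> Z seq_closure_of A.
     \<forall>s :: nat \<Rightarrow> 'a. range s \<subseteq> A \<and> limitin Z s x sequentially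
         \<and> x \<in> Z closure_of (A - range s) \<longrightarrow>
       (\<exists>t :: nat \<Rightarrow> 'a. range t \<subseteq> A - range s \<and> limitin Z t x sequentially)}"

definition sigma_separable_space :: "'a topology \<Rightarrow> bool" where
  "sigma_separable_space Z \<longleftrightarrow>
     (\<exists>A. countable A \<and> A \<subseteq> topspace Z \<and> Z sigma_closure_of A = topspace Z)"

definition cozero_in :: "'a topology \<Rightarrow> 'a set \<Rightarrow> bool" where
  "cozero_in X U \<longleftrightarrow>
     (\<exists>g. continuous_map X euclideanreal g \<and> U = {x \<in> topspace X. g x \<noteq> 0})"

definition velichko_map :: "'a topology \<Rightarrow> 'b metric \<Rightarrow> ('a \<Rightarrow> 'b) \<Rightarrow> bool" where
  "velichko_map X Y f \<longleftrightarrow>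
     separable_space (mtopology_of Y)
     \<and> continuous_map X (mtopology_of Y) f
     \<and> bij_betw f (topspace X) (mspace Y)
     \<and> (\<forall>U. cozero_in X U \<longrightarrow> fsigma_in (mtopology_of Y) (f ` U))"

text \<open>HOL cannot quantify over the type of the points of \<^term>\<open>Y\<close>. As \<^term>\<open>f\<close> is a bijection,
  nothing is lost by taking \<^term>\<open>Y\<close> on the point type of \<^term>\<open>X\<close>; the lemma
  \<open>velichko_property_if_velichko_map\<close> below covers \<^term>\<open>Y\<close> over an arbitrary type.\<close>

definition velichko_property :: "'a topology \<Rightarrow> bool" where
  "velichko_property X \<longleftrightarrow> (\<exists>(Y :: 'a metric) f. velichko_map X Y f)"

lemma velichko_property_if_velichko_map:
  fixes X :: "'a topology" and Y :: "'b metric"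
  assumes "velichko_map X Y f"
  shows "velichko_property X"
proof -
  let ?M = "topspace X" and ?d = "\<lambda>x y. mdist Y (f x) (f y)"
  have sep: "separable_space (mtopology_of Y)" and cont: "continuous_map X (mtopology_of Y) f"
    and bij: "bij_betw f ?M (mspace Y)"
    and fs: "\<And>U. cozero_in X U \<Longrightarrow> fsigma_in (mtopology_of Y) (f ` U)"
    using assms by (auto simp: velichko_map_def)
  have inY: "x \<in> ?M \<Longrightarrow> f x \<in> mspace Y" for x
    using bij by (auto simp: bij_betw_def)
  interpret M: Metric_space ?M ?d
  proof
    show "0 \<le> ?d x y" for x y
      by simp
    show "?d x y = ?d y x" for x y
      by (rule mdist_commute)
    show "?d x y = 0 \<longleftrightarrow> x = y" if "x \<in> ?M" "y \<in> ?M" for x y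
      using inY[OF that(1)] inY[OF that(2)] inj_onD[OF bij_betw_imp_inj_on[OF bij] _ that] by auto
    show "?d x z \<le> ?d x y + ?d y z" if "x \<in> ?M" "y \<in> ?M" "z \<in> ?M" for x y z
      using that by (intro mdist_triangle inY)
  qed
  define Y' where "Y' = metric (?M, ?d)"
  have Y': "mspace Y' = ?M" "mdist Y' = ?d"
    by (simp_all add: Y'_def M.mspace_metric M.mdist_metric)
  let ?T = "mtopology_of Y" and ?T' = "mtopology_of Y'"
  define g where "g = inv_into ?M f"
  have gin: "g y \<in> ?M" "f (g y) = y" if "y \<in> mspace Y" for y
    using that bij unfolding g_def
    by (auto simp: bij_betw_inv_into_right bij_betw_imp_surj_on inv_into_into)
  have gf: "g (f x) = x" if "x \<in> ?M" for x
    using that bij unfolding g_def by (simp add: bij_betw_inv_into_left)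
  have hom: "homeomorphic_maps ?T' ?T f g"
  proof -
    have "continuous_map ?T' ?T f"
      by (rule Lipschitz_continuous_imp_continuous_map)
         (auto simp: Lipschitz_continuous_map_def Y' inY intro!: exI[of _ 1])
    moreover have "continuous_map ?T ?T' g"
      by (rule Lipschitz_continuous_imp_continuous_map)
         (auto simp: Lipschitz_continuous_map_def Y' gin intro!: exI[of _ 1])
    ultimately show ?thesis
      by (auto simp: homeomorphic_maps_def Y' gin gf)
  qed
  then have hg: "homeomorphic_map ?T ?T' g"
    using homeomorphic_maps_map by blast
  have "separable_space ?T'"
    by (rule separable_space_continuous_map_image[OF sep homeomorphic_imp_continuous_map[OF hg]])
       (rule homeomorphic_imp_surjective_map[OF hg])
  moreover have "continuous_map X ?T' id"
  proof -
    have "continuous_map X ?T' (g \<circ> f)"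
      using cont homeomorphic_imp_continuous_map[OF hg] by (rule continuous_map_compose)
    then show ?thesis
      by (rule continuous_map_eq) (simp add: gf)
  qed
  moreover have "fsigma_in ?T' (id ` U)" if U: "cozero_in X U" for U
  proof -
    have UX: "U \<subseteq> ?M"
      using U by (auto simp: cozero_in_def)
    obtain \<C> where C: "countable \<C>" "\<C> \<subseteq> Collect (closedin ?T)" "\<Union>\<C> = f ` U"
      using fs[OF U] unfolding fsigma_in_def union_of_def by (elim exE conjE)
    have "g ` f ` U = (\<lambda>x. x) ` U"
      unfolding image_image using UX gf by (intro image_cong) auto
    then have "U = g ` f ` U" by simp
    also have "\<dots> = \<Union>((`) g ` \<C>)"
      unfolding C(3)[symmetric] by (rule image_Union)
    finally have "\<Union>((`) g ` \<C>) = U" by (rule sym)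
    moreover have "closedin ?T' (g ` C)" if "C \<in> \<C>" for C
      using homeomorphic_imp_closed_map[OF hg] subsetD[OF C(2) that] by (simp add: closed_map_def)
    moreover have "countable ((`) g ` \<C>)"
      using C(1) by simp
    ultimately show ?thesis
      unfolding fsigma_in_def union_of_def image_id id_apply
      by (intro exI[of _ "(`) g ` \<C>"] conjI) auto
  qed
  ultimately have "velichko_map X Y' id"
    by (simp add: velichko_map_def Y')
  then show ?thesis
    by (auto simp: velichko_property_def)
qed

end

theory Submission
  imports Defs
begin

text \<open>A countable sequentially dense \<open>A\<close> becomes \<open>\<sigma>\<close>-dense after adding all rational translates: an
  approximating sequence can be moved off any given convergent sequence by small constants. The
  evaluation \<open>x \<mapsto> (a x)\<^sub>a\<close> along \<open>A\<close> is a Velichko map, since a continuous function on \<open>X\<close>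
  is a pointwise limit of coordinate projections. Conversely, along a Velichko map \<open>f\<close> every
  continuous function on \<open>X\<close> is \<open>F\<^sub>\<sigma>\<close>-measurable, and the Lebesgue-Hausdorff argument exhibits it
  as a limit of functions from one fixed countable algebra, generated by the rational constants and
  the distances of \<open>f x\<close> to a countable dense set. The fixed algebra is essential because
  sequential closure is not idempotent.\<close>

section \<open>Points and convergent sequences of \<open>Cp X\<close>\<close>

lemma topspace_Cp:
  "topspace (Cp X) = {f \<in> extensional (topspace X). continuous_map X euclideanreal f}"
  by (auto simp: Cp_def PiE_def)

text \<open>Convergence in a product is coordinatewise. Membership of the \<open>s n\<close> is only
  eventual because limits ignore initial terms.\<close>

lemma limitin_Cp:
  "limitin (Cp X) s g sequentially \<longleftrightarrow>
     g \<in> topspace (Cp X) \<and> (\<forall>\<^sub>F n in sequentially. s n \<in> topspace (Cp X))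
     \<and> (\<forall>x\<in>topspace X. (\<lambda>n. s n x) \<longlonglongrightarrow> g x)"
  unfolding Cp_def limitin_subtopology limitin_componentwise limitin_canonical_iff
  by (auto simp: PiE_def eventually_conj_iff)

lemma limitin_CpI:
  assumes "g \<in> topspace (Cp X)" "range s \<subseteq> topspace (Cp X)"
    and "\<And>x. x \<in> topspace X \<Longrightarrow> (\<lambda>n. s n x) \<longlonglongrightarrow> g x"
  shows "limitin (Cp X) s g sequentially"
  using assms by (auto simp: limitin_Cp intro!: always_eventually)

lemma restrict_in_Cp:
  "continuous_map X euclideanreal f \<Longrightarrow> restrict f (topspace X) \<in> topspace (Cp X)"
  by (auto simp: topspace_Cp intro: continuous_map_eq)

lemma seq_closure_of_subset: "Z seq_closure_of A \<subseteq> topspace Z"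
  unfolding seq_closure_of_def using limitin_topspace by fastforce

section \<open>Sequential separability and \<sigma>-separability\<close>

lemma sigma_imp_sequentially_separable:
  "sigma_separable_space Z \<Longrightarrow> sequentially_separable_space Z"
  unfolding sigma_separable_space_def sequentially_separable_space_def
  using seq_closure_of_subset by (fastforce simp: sigma_closure_of_def)

text \<open>A convergent sequence together with its limit is closed and countable, whereas the rational
  translates of a point by less than \<open>e\<close> are dense in an interval.\<close>

lemma small_rational_shift_avoiding_sequence:
  fixes s :: "nat \<Rightarrow> real"
  assumes "s \<longlonglongrightarrow> l" "0 < e"
  shows "\<exists>q\<in>\<rat>. 0 < q \<and> q < e \<and> a + q \<notin> range s"
proof (rule ccontr)
  assume "\<not> ?thesis"
  then have *: "a + q \<in> range s" if "q \<in> \<rat>" "0 < q" "q < e" for q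
    using that by blast
  have "{a<..<a+e} \<subseteq> closure (insert l (range s))"
  proof
    fix z assume z: "z \<in> {a<..<a+e}"
    show "z \<in> closure (insert l (range s))"
      unfolding closure_approachable
    proof (intro allI impI)
      fix d :: real assume "0 < d"
      then obtain q where q: "q \<in> \<rat>" "z - a < q" "q < min e (z - a + d)"
        using z Rats_dense_in_real[of "z - a" "min e (z - a + d)"] by auto
      then have "a + q \<in> range s"
        using z by (intro *) auto
      moreover have "dist (a + q) z < d"
        using q by (auto simp: dist_real_def)
      ultimately show "\<exists>y\<in>insert l (range s). dist y z < d" by blast
    qed
  qed
  also have "\<dots> = insert l (range s)"
    by (simp add: closure_closed compact_imp_closed compact_sequence_with_limit assms)
  finally have "countable {a<..<a+e}"
    by (rule countable_subset) auto
  then show False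
    using uncountable_open_interval[of a "a + e"] assms(2) by simp
qed

lemma sequentially_imp_sigma_separable_Cp:
  assumes "sequentially_separable_space (Cp X)"
  shows "sigma_separable_space (Cp X)"
proof -
  let ?S = "topspace X"
  obtain A where A: "countable A" "A \<subseteq> topspace (Cp X)" "Cp X seq_closure_of A = topspace (Cp X)"
    using assms unfolding sequentially_separable_space_def by blast
  \<comment> \<open>Restricting to \<open>?S\<close> keeps the translates extensional, as points of
    \<open>Cp X\<close> must be.\<close>
  define shift where "shift a q = (\<lambda>x\<in>?S. a x + q)" for a :: "'a \<Rightarrow> real" and q
  define B where "B = (\<lambda>(a, q). shift a q) ` (A \<times> \<rat>)"
  have countB: "countable B"
    unfolding B_def using A(1) countable_rat by (intro countable_image countable_SIGMA)
  have shift_B: "shift a q \<in> B" if "a \<in> A" "q \<in> \<rat>" for a q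
    using that by (auto simp: B_def)
  have B_sub: "B \<subseteq> topspace (Cp X)"
  proof
    fix b assume "b \<in> B"
    then obtain a q where "a \<in> A" "b = shift a q" by (auto simp: B_def)
    moreover from this have "continuous_map X euclideanreal (\<lambda>x. a x + q)"
      using A(2) by (auto simp: topspace_Cp intro!: continuous_intros)
    ultimately show "b \<in> topspace (Cp X)"
      unfolding shift_def by (auto intro: restrict_in_Cp)
  qed
  have A_seq: "\<exists>w. range w \<subseteq> A \<and> limitin (Cp X) w g sequentially" if "g \<in> topspace (Cp X)" for g
    using that unfolding A(3)[symmetric] seq_closure_of_def by blast
  have B_seq: "g \<in> Cp X seq_closure_of B" if g: "g \<in> topspace (Cp X)" for g
  proof -
    obtain w where w: "range w \<subseteq> A" "limitin (Cp X) w g sequentially"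
      using A_seq[OF g] by blast
    have "shift (w n) 0 \<in> B" for n
      using w(1) by (intro shift_B) auto
    moreover from this have "limitin (Cp X) (\<lambda>n. shift (w n) 0) g sequentially"
      using w(2) B_sub g by (intro limitin_CpI) (auto simp: limitin_Cp shift_def)
    ultimately show ?thesis
      unfolding seq_closure_of_def by (intro CollectI exI[of _ "\<lambda>n. shift (w n) 0"]) auto
  qed
  have avoid: "\<exists>t. range t \<subseteq> B - range s \<and> limitin (Cp X) t g sequentially"
    if g: "g \<in> topspace (Cp X)" and s: "range s \<subseteq> B" "limitin (Cp X) s g sequentially"
      and cl: "g \<in> Cp X closure_of (B - range s)" for g s
  proof -
    \<comment> \<open>A point is required at which to compare values. Were \<open>X\<close> empty,
      \<open>Cp X\<close> would have at most one point, so \<open>s\<close> would exhaust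
      \<open>B\<close>, and the closure of the empty set cannot contain \<open>g\<close>.\<close>
    have "?S \<noteq> {}"
    proof
      assume "?S = {}"
      then have "topspace (Cp X) \<subseteq> {\<lambda>_. undefined}"
        by (auto simp: topspace_Cp)
      then have "b = s 0" if "b \<in> B" for b
        using B_sub s(1) that by (metis rangeI singletonD subset_iff)
      then have empty: "B - range s = {}" by blast
      show False using cl unfolding empty by simp
    qed
    then obtain x0 where x0: "x0 \<in> ?S" by blast
    obtain w where w: "range w \<subseteq> A" "limitin (Cp X) w g sequentially"
      using A_seq[OF g] by blast
    \<comment> \<open>Differing from every \<open>s k\<close> at the single point \<open>x0\<close>
      already keeps a translate off \<open>range s\<close>. The bound on \<open>q\<close> forces the
      shifts to 0, so the limit stays \<open>g\<close>.\<close>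
    have "\<forall>n. \<exists>q. q \<in> \<rat> \<and> 0 < q \<and> q < inverse (real (Suc n)) \<and> shift (w n) q \<notin> range s"
    proof
      fix n
      have "(\<lambda>k. s k x0) \<longlonglongrightarrow> g x0"
        using s(2) x0 by (simp add: limitin_Cp)
      from small_rational_shift_avoiding_sequence[OF this, of "inverse (real (Suc n))" "w n x0"]
      obtain q where q: "q \<in> \<rat>" "0 < q" "q < inverse (real (Suc n))"
        "w n x0 + q \<notin> range (\<lambda>k. s k x0)" by auto
      have "shift (w n) q \<notin> range s"
      proof
        assume "shift (w n) q \<in> range s"
        then obtain k where "s k = shift (w n) q" by auto
        then have "s k x0 = w n x0 + q"
          using x0 by (simp add: shift_def)
        then show False
          using q(4) rangeI[of "\<lambda>k. s k x0" k] by simp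
      qed
      then show "\<exists>q. q \<in> \<rat> \<and> 0 < q \<and> q < inverse (real (Suc n)) \<and> shift (w n) q \<notin> range s"
        using q(1-3) by (intro exI[of _ q]) simp
    qed
    from choice[OF this] obtain q where
      "\<forall>n. q n \<in> \<rat> \<and> 0 < q n \<and> q n < inverse (real (Suc n)) \<and> shift (w n) (q n) \<notin> range s" ..
    then have q: "\<And>n. q n \<in> \<rat>" "\<And>n. 0 < q n" "\<And>n. q n < inverse (real (Suc n))"
      "\<And>n. shift (w n) (q n) \<notin> range s"
      by simp_all
    have tB: "range (\<lambda>n. shift (w n) (q n)) \<subseteq> B"
      using w(1) q(1) by (intro image_subsetI shift_B) auto
    have "q \<longlonglongrightarrow> 0"
    proof (rule tendsto_sandwich)
      show "\<forall>\<^sub>F n in sequentially. 0 \<le> q n"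
        using q(2) by (intro always_eventually) (simp add: less_imp_le)
      show "\<forall>\<^sub>F n in sequentially. q n \<le> inverse (real (Suc n))"
        using q(3) by (intro always_eventually) (simp add: less_imp_le)
    qed (rule tendsto_const LIMSEQ_inverse_real_of_nat)+
    then have "(\<lambda>n. shift (w n) (q n) x) \<longlonglongrightarrow> g x" if "x \<in> ?S" for x
      using tendsto_add[of "\<lambda>n. w n x" "g x" sequentially q 0] w(2) that
      by (simp add: limitin_Cp shift_def)
    then have "limitin (Cp X) (\<lambda>n. shift (w n) (q n)) g sequentially"
      using g tB B_sub by (intro limitin_CpI) auto
    then show ?thesis
      using tB q(4) by (intro exI[of _ "\<lambda>n. shift (w n) (q n)"]) auto
  qed
  have "Cp X sigma_closure_of B = topspace (Cp X)"
    unfolding sigma_closure_of_def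
  proof (intro subset_antisym subsetI CollectI conjI allI impI)
    fix g assume "g \<in> topspace (Cp X)"
    then show "g \<in> Cp X seq_closure_of B" by (rule B_seq)
  next
    fix g s
    assume "g \<in> topspace (Cp X)"
      "range s \<subseteq> B \<and> limitin (Cp X) s g sequentially \<and> g \<in> Cp X closure_of (B - range s)"
    then show "\<exists>t. range t \<subseteq> B - range s \<and> limitin (Cp X) t g sequentially"
      using avoid by simp
  qed (auto dest: subsetD[OF seq_closure_of_subset])
  then show ?thesis
    using countB B_sub unfolding sigma_separable_space_def by (intro exI[of _ B] conjI)
qed

section \<open>The evaluation map as a Velichko map\<close>

lemma sequentially_separable_Cp_imp_velichko:
  assumes X: "tychonoff_space X" and sep: "sequentially_separable_space (Cp X)"
  shows "velichko_property X"
proof -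
  let ?S = "topspace X"
  obtain A where A: "countable A" "A \<subseteq> topspace (Cp X)" "Cp X seq_closure_of A = topspace (Cp X)"
    using sep unfolding sequentially_separable_space_def by blast
  have A_seq: "\<exists>w. range w \<subseteq> A \<and> limitin (Cp X) w g sequentially" if "g \<in> topspace (Cp X)" for g
    using that unfolding A(3)[symmetric] seq_closure_of_def by blast
  \<comment> \<open>The zero function is a limit of points of \<open>A\<close>; nonemptiness makes
    \<open>A\<close> the range of a sequence.\<close>
  have "A \<noteq> {}"
    using A_seq[OF restrict_in_Cp[of X "\<lambda>_. 0"]] by fastforce
  define a where "a = from_nat_into A"
  have rangea: "range a = A"
    using \<open>A \<noteq> {}\<close> A(1) by (simp add: a_def range_from_nat_into)
  have a_cont: "continuous_map X euclideanreal (a n)" for n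
    using A(2) rangea by (auto simp: topspace_Cp)
  have approx: "\<exists>r. \<forall>x\<in>?S. (\<lambda>m. a (r m) x) \<longlonglongrightarrow> g x" if g: "continuous_map X euclideanreal g" for g
  proof -
    obtain w where w: "range w \<subseteq> A" "limitin (Cp X) w (restrict g ?S) sequentially"
      using A_seq[OF restrict_in_Cp[OF g]] by blast
    have "\<exists>k. w m = a k" for m
      using w(1) rangea by (metis imageE rangeI subset_iff)
    then obtain r where "\<And>m. w m = a (r m)" by metis
    then have "w = (\<lambda>m. a (r m))" by auto
    then show ?thesis
      using w(2) by (auto simp: limitin_Cp)
  qed
  define e where "e x = (\<lambda>n. a n x)" for x
  \<comment> \<open>The metric on \<open>nat \<Rightarrow> real\<close> induces the product
    topology, so continuity of \<open>e\<close> can be checked coordinatewise.\<close>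
  define Y where "Y = submetric euclidean_metric (e ` ?S)"
  have Y: "mspace Y = e ` ?S" "mtopology_of Y = top_of_set (e ` ?S)"
    by (simp_all add: Y_def mtopology_of_submetric)
  have "separable_space (mtopology_of Y)"
  proof -
    obtain D where D: "countable D" "D \<subseteq> e ` ?S" "e ` ?S \<subseteq> closure D"
      using separable by blast
    then have "top_of_set (e ` ?S) closure_of D = e ` ?S"
      by (auto simp: closure_of_subtopology Int_absorb1)
    then show ?thesis
      using D unfolding separable_space_def Y by auto
  qed
  moreover have "continuous_map X (mtopology_of Y) e"
  proof -
    have "continuous_map X euclidean e"
      unfolding euclidean_product_topology[symmetric] continuous_map_componentwise_UNIV
      by (simp add: e_def a_cont)
    then show ?thesis
      by (simp add: Y continuous_map_in_subtopology)
  qed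
  moreover have "bij_betw e ?S (mspace Y)"
    unfolding Y(1)
  proof (rule inj_on_imp_bij_betw, rule inj_onI, rule ccontr)
    fix x y assume xy: "x \<in> ?S" "y \<in> ?S" "e x = e y" "x \<noteq> y"
    \<comment> \<open>Complete regularity separates \<open>x\<close> from \<open>y\<close> by some
      \<open>g\<close>, yet \<open>g\<close> is a pointwise limit of members of \<open>A\<close>,
      all of which agree at \<open>x\<close> and \<open>y\<close>.\<close>
    have "closedin X {y}" "completely_regular_space X"
      using X xy by (auto simp: tychonoff_space_def t1_space_closedin_singleton)
    then obtain g :: "'a \<Rightarrow> real" where g: "continuous_map X (top_of_set {0..1}) g" "g x = 0" "g y = 1"
      unfolding completely_regular_space_def using xy by (auto dest!: spec[of _ "{y}"])
    then obtain r where r: "\<forall>x\<in>?S. (\<lambda>m. a (r m) x) \<longlonglongrightarrow> g x"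
      using approx[of g] by (auto simp: continuous_map_in_subtopology)
    have "(\<lambda>m. a (r m) x) = (\<lambda>m. a (r m) y)"
      using xy(3) by (auto simp: e_def fun_eq_iff)
    then have "g x = g y"
      using r xy LIMSEQ_unique by metis
    then show False using g by simp
  qed
  moreover have "fsigma_in (mtopology_of Y) (e ` U)" if U: "cozero_in X U" for U
  proof -
    obtain g where g: "continuous_map X euclideanreal g" "U = {x \<in> ?S. g x \<noteq> 0}"
      using U by (auto simp: cozero_in_def)
    obtain r where r: "\<forall>x\<in>?S. (\<lambda>m. a (r m) x) \<longlonglongrightarrow> g x"
      using approx[OF g(1)] by blast
    \<comment> \<open>\<open>g x\<close> is nonzero iff for some \<open>k\<close> and
      \<open>m\<close> all \<open>\<bar>a (r n) x\<bar>\<close> with \<open>n \<ge> m\<close> are at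
      least \<open>1 / (k + 1)\<close>: the non-strict bound survives the limit. On the coordinates
      of \<open>e x\<close> these are closed conditions.\<close>
    define F where "F k m = (\<Inter>n\<in>{m..}. {y \<in> e ` ?S. \<bar>y (r n)\<bar> \<ge> inverse (real (Suc k))})" for k m
    have closedF: "closedin (top_of_set (e ` ?S)) (F k m)" for k m
      unfolding F_def
    proof (rule closedin_Inter)
      fix K assume "K \<in> (\<lambda>n. {y \<in> e ` ?S. \<bar>y (r n)\<bar> \<ge> inverse (real (Suc k))}) ` {m..}"
      then obtain n where K: "K = {y \<in> e ` ?S. \<bar>y (r n)\<bar> \<ge> inverse (real (Suc k))}" by blast
      have "continuous_on UNIV (\<lambda>y::nat \<Rightarrow> real. \<bar>y (r n)\<bar>)"
        by (intro continuous_on_rabs continuous_on_product_coordinates)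
      then have "closed {y::nat \<Rightarrow> real. \<bar>y (r n)\<bar> \<ge> inverse (real (Suc k))}"
        by (intro closed_Collect_le continuous_on_const)
      then show "closedin (top_of_set (e ` ?S)) K"
        unfolding K closedin_closed by blast
    qed auto
    have "e ` U = (\<Union>(k, m)\<in>UNIV. F k m)"
    proof (intro subset_antisym subsetI)
      fix y assume "y \<in> e ` U"
      then obtain x where x: "x \<in> ?S" "g x \<noteq> 0" "y = e x" by (auto simp: g)
      have lim: "(\<lambda>m. \<bar>a (r m) x\<bar>) \<longlonglongrightarrow> \<bar>g x\<bar>"
        using r x by (intro tendsto_rabs) auto
      obtain k where "inverse (real (Suc k)) < \<bar>g x\<bar>"
        using reals_Archimedean[of "\<bar>g x\<bar>"] x by auto
      from order_tendstoD(1)[OF lim this]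
      obtain m where "\<And>n. n \<ge> m \<Longrightarrow> inverse (real (Suc k)) < \<bar>a (r n) x\<bar>"
        by (auto simp: eventually_sequentially)
      then have "y \<in> F k m"
        using x by (force simp: F_def e_def)
      then show "y \<in> (\<Union>(k, m)\<in>UNIV. F k m)" by blast
    next
      fix y assume "y \<in> (\<Union>(k, m)\<in>UNIV. F k m)"
      then obtain k m where km: "y \<in> F k m" by blast
      then obtain x where x: "x \<in> ?S" "y = e x" by (auto simp: F_def)
      have "inverse (real (Suc k)) \<le> \<bar>g x\<bar>"
      proof (rule tendsto_lowerbound)
        show "(\<lambda>m. \<bar>a (r m) x\<bar>) \<longlonglongrightarrow> \<bar>g x\<bar>"
          using r x by (intro tendsto_rabs) auto
        show "\<forall>\<^sub>F n in sequentially. inverse (real (Suc k)) \<le> \<bar>a (r n) x\<bar>"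
          using km by (auto simp: eventually_sequentially F_def x e_def intro!: exI[of _ m])
      qed simp
      moreover have "0 < inverse (real (Suc k))" by simp
      ultimately have "g x \<noteq> 0" by linarith
      then show "y \<in> e ` U"
        using x g by blast
    qed
    then show ?thesis
      unfolding Y(2) using closedF
      by (auto simp del: Union_iff split: prod.splits intro!: fsigma_in_Union intro: closed_imp_fsigma_in)
  qed
  ultimately have "velichko_map X Y e"
    by (simp add: velichko_map_def)
  \<comment> \<open>The points of \<open>Y\<close> have type \<open>nat \<Rightarrow> real\<close>;
    the metric is pulled back to \<open>X\<close> along the bijection.\<close>
  then show ?thesis
    by (rule velichko_property_if_velichko_map)
qed

section \<open>Countable lattice algebras and their pointwise limits\<close>

text \<open>Each stage of the iteration is countable, and since the stages increase, two elements of
  the union lie in a common one. This supplies the countable family of approximants.\<close>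

lemma countable_closure_under_binary_operations:
  fixes G :: "'b set" and OPS :: "('b \<Rightarrow> 'b \<Rightarrow> 'b) set"
  assumes "countable G" "countable OPS"
  obtains A where "countable A" "G \<subseteq> A" "\<And>f a b. f \<in> OPS \<Longrightarrow> a \<in> A \<Longrightarrow> b \<in> A \<Longrightarrow> f a b \<in> A"
proof
  define step where "step B = B \<union> (\<Union>f\<in>OPS. (\<lambda>(a, b). f a b) ` (B \<times> B))" for B
  define S where "S n = (step ^^ n) G" for n
  have Suc: "S (Suc n) = step (S n)" for n
    by (simp add: S_def)
  have "countable (S n)" for n
  proof (induction n)
    case 0
    then show ?case using assms by (simp add: S_def)
  next
    case (Suc n)
    then show ?case
      unfolding \<open>S (Suc n) = step (S n)\<close> step_def using assms
      by (intro countable_Un countable_UN countable_image countable_SIGMA) auto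
  qed
  then show "countable (\<Union>n. S n)" by simp
  have "S 0 = G" by (simp add: S_def)
  then show "G \<subseteq> (\<Union>n. S n)" by blast
  have "S n \<subseteq> S (Suc n)" for n
    by (auto simp: Suc step_def)
  then have mono: "S m \<subseteq> S n" if "m \<le> n" for m n
    using that by (rule lift_Suc_mono_le)
  fix f a b
  assume f: "f \<in> OPS" "a \<in> (\<Union>n. S n)" "b \<in> (\<Union>n. S n)"
  then obtain m n where "a \<in> S m" "b \<in> S n" by blast
  then have "a \<in> S (max m n)" "b \<in> S (max m n)"
    using mono[of m "max m n"] mono[of n "max m n"] by auto
  then have "f a b \<in> S (Suc (max m n))"
    using f(1) by (force simp: Suc step_def)
  then show "f a b \<in> (\<Union>n. S n)" by blast
qed

text \<open>Restricting to rational constants leaves room for \<open>A\<close> to be countable.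
  Truncation through \<open>max\<close> lets approximants attain the values 0 and 1 exactly.\<close>

locale rational_lattice_algebra =
  fixes A :: "('a \<Rightarrow> real) set"
  assumes const: "q \<in> \<rat> \<Longrightarrow> (\<lambda>_. q) \<in> A"
    and add: "f \<in> A \<Longrightarrow> g \<in> A \<Longrightarrow> (\<lambda>x. f x + g x) \<in> A"
    and mult: "f \<in> A \<Longrightarrow> g \<in> A \<Longrightarrow> (\<lambda>x. f x * g x) \<in> A"
    and max: "f \<in> A \<Longrightarrow> g \<in> A \<Longrightarrow> (\<lambda>x. max (f x) (g x)) \<in> A"
begin

lemma diff:
  assumes "f \<in> A" "g \<in> A"
  shows "(\<lambda>x. f x - g x) \<in> A"
  using add[OF assms(1) mult[OF const[of "-1"] assms(2)]] by simp

lemma min: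
  assumes "f \<in> A" "g \<in> A"
  shows "(\<lambda>x. min (f x) (g x)) \<in> A"
proof -
  have "(\<lambda>x. f x + g x - max (f x) (g x)) \<in> A"
    by (intro diff add max assms)
  moreover have "(\<lambda>x. f x + g x - max (f x) (g x)) = (\<lambda>x. min (f x) (g x))"
    by (auto simp: fun_eq_iff min_def max_def)
  ultimately show ?thesis by simp
qed

lemma sum:
  assumes "\<And>i. i \<in> I \<Longrightarrow> f i \<in> A"
  shows "(\<lambda>x. \<Sum>i\<in>I. f i x) \<in> A"
  using assms
proof (induction I rule: infinite_finite_induct)
  case (insert i I)
  then have "(\<lambda>x. f i x + (\<Sum>i\<in>I. f i x)) \<in> A"
    by (intro add) auto
  then show ?case using insert.hyps by simp
\<comment> \<open>A sum over an infinite set is 0 by convention, so this case, like the empty one,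
  yields a rational constant.\<close>
qed (simp_all add: const)

lemma prod:
  assumes "\<And>i. i \<in> I \<Longrightarrow> f i \<in> A"
  shows "(\<lambda>x. \<Prod>i\<in>I. f i x) \<in> A"
  using assms
proof (induction I rule: infinite_finite_induct)
  case (insert i I)
  then have "(\<lambda>x. f i x * (\<Prod>i\<in>I. f i x)) \<in> A"
    by (intro mult) auto
  then show ?case using insert.hyps by simp
qed (simp_all add: const)

text \<open>Eventual equality is asked for instead of convergence: finitely many approximants then
  take their exact values at once, so products of them can select a single term of a sum.\<close>

definition indicator_approximable :: "'a set \<Rightarrow> 'a set \<Rightarrow> bool" where
  "indicator_approximable S C \<longleftrightarrow>
     (\<exists>u :: nat \<Rightarrow> 'a \<Rightarrow> real. range u \<subseteq> A \<and>
        (\<forall>x\<in>S. \<forall>\<^sub>F m in sequentially. u m x = indicator C x))"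

text \<open>With \<open>p\<close> enumerating \<open>F\<close>, take the positive part of
  \<open>1 - m * (\<Sum>j\<le>m. p j x)\<close>. On \<open>C\<close> the sum vanishes and the value
  is 1; off \<open>C\<close> some \<open>p j x\<close> is positive, and the factor \<open>m\<close>
  eventually pushes the value down to 0.\<close>

lemma indicator_approximable_zero_set:
  assumes F: "countable F" "F \<subseteq> A"
    and nonneg: "\<And>f x. f \<in> F \<Longrightarrow> x \<in> S \<Longrightarrow> 0 \<le> f x"
    and vanish: "\<And>f x. f \<in> F \<Longrightarrow> x \<in> S \<inter> C \<Longrightarrow> f x = 0"
    and pos: "\<And>x. x \<in> S - C \<Longrightarrow> \<exists>f\<in>F. 0 < f x"
  shows "indicator_approximable S C"
proof -
  \<comment> \<open>The added zero function makes \<open>G\<close> nonempty, so that it can be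
    enumerated even if \<open>F\<close> is empty.\<close>
  define G where "G = insert (\<lambda>_. 0) F"
  define p where "p = from_nat_into G"
  have rangep: "range p = G"
    using F(1) by (simp add: p_def G_def range_from_nat_into)
  have pA: "p j \<in> A" for j
    using F(2) const[of 0] rangeI[of p j] unfolding rangep by (auto simp: G_def)
  have p0: "0 \<le> p j x" if "x \<in> S" for j x
  proof -
    have "p j \<in> G" using rangep by blast
    then show ?thesis using nonneg that by (auto simp: G_def)
  qed
  define u where "u m = (\<lambda>x. max 0 (1 - real m * (\<Sum>j\<le>m. p j x)))" for m
  have "range u \<subseteq> A"
    unfolding u_def by (auto intro!: max diff mult sum const pA)
  moreover have "\<forall>\<^sub>F m in sequentially. u m x = indicator C x" if x: "x \<in> S" for x
  proof (cases "x \<in> C")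
    case True
    have "p j x = 0" for j
    proof -
      have "p j \<in> G" using rangep by blast
      then show ?thesis using vanish x True by (auto simp: G_def)
    qed
    then show ?thesis
      using True by (simp add: u_def)
  next
    case False
    then obtain f where "f \<in> F" "0 < f x"
      using pos x by blast
    then obtain j where j: "0 < p j x"
      using rangep by (metis G_def insertCI imageE)
    obtain N where N: "1 < real N * p j x"
      using reals_Archimedean3[OF j] by blast
    \<comment> \<open>\<open>m \<ge> j\<close> puts \<open>p j\<close> into the sum, and
      \<open>m \<ge> N\<close> makes its multiple exceed 1.\<close>
    have "u m x = 0" if "m \<ge> max N j" for m
    proof -
      have "p j x \<le> (\<Sum>j\<le>m. p j x)"
        using that p0[OF x] by (intro member_le_sum) auto
      then have "real N * p j x \<le> real m * (\<Sum>j\<le>m. p j x)"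
        using that j by (intro mult_mono) auto
      then show ?thesis using N by (simp add: u_def)
    qed
    then show ?thesis
      using False unfolding eventually_sequentially by (intro exI[of _ "max N j"]) simp
  qed
  ultimately show ?thesis
    unfolding indicator_approximable_def by blast
qed

text \<open>The approximants are \<open>\<Sum>k<m. c\<^sub>k u\<^sub>k \<Prod>l<k. (1 - u\<^sub>l)\<close>, where \<open>u\<^sub>k\<close> is the \<open>m\<close>-th approximant of the
  indicator of the \<open>k\<close>-th set: at \<open>x\<close> they stabilise at \<open>c\<^sub>k\<close> for the least \<open>k\<close> whose set contains \<open>x\<close>.\<close>

lemma approximable_selection:
  assumes P: "countable P" and Q: "\<And>C q. (C, q) \<in> P \<Longrightarrow> q \<in> \<rat> \<and> indicator_approximable S C"
    and cover: "\<And>x. x \<in> S \<Longrightarrow> \<exists>(C, q)\<in>P. x \<in> C"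
  obtains h :: "nat \<Rightarrow> 'a \<Rightarrow> real" where "range h \<subseteq> A"
    "\<And>x. x \<in> S \<Longrightarrow> \<exists>(C, q)\<in>P. x \<in> C \<and> (\<forall>\<^sub>F m in sequentially. h m x = q)"
proof (cases "S = {}")
  case True
  \<comment> \<open>Here \<open>P\<close> may be empty and have no enumeration; the zero sequence
    serves.\<close>
  then show thesis
    using that[of "\<lambda>_ _. 0"] const[of 0] by auto
next
  case False
  then have "P \<noteq> {}" using cover by auto
  define C where "C k = fst (from_nat_into P k)" for k
  define c where "c k = snd (from_nat_into P k)" for k
  have inP: "(C k, c k) \<in> P" for k
    using from_nat_into[OF \<open>P \<noteq> {}\<close>] by (simp add: C_def c_def)
  have "\<forall>k. \<exists>u. range u \<subseteq> A \<and> (\<forall>x\<in>S. \<forall>\<^sub>F m in sequentially. u m x = (indicator (C k) x :: real))"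
    using Q[OF inP] by (auto simp: indicator_approximable_def)
  from choice[OF this] obtain u where u: "\<And>k. range (u k) \<subseteq> A"
    "\<And>k x. x \<in> S \<Longrightarrow> \<forall>\<^sub>F m in sequentially. u k m x = (indicator (C k) x :: real)"
    by blast
  define h where "h m = (\<lambda>x. \<Sum>k<m. c k * (u k m x * (\<Prod>l<k. 1 - u l m x)))" for m
  have "range h \<subseteq> A"
    unfolding h_def using u(1) Q[OF inP] by (auto intro!: sum mult prod diff const)
  moreover have "\<exists>(C, q)\<in>P. x \<in> C \<and> (\<forall>\<^sub>F m in sequentially. h m x = q)" if x: "x \<in> S" for x
  proof -
    define K where "K = (LEAST k. x \<in> C k)"
    obtain C' q where "(C', q) \<in> P" "x \<in> C'" using cover[OF x] by blast
    moreover from this obtain k where "from_nat_into P k = (C', q)"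
      using from_nat_into_surj[OF P] by blast
    ultimately have "\<exists>k. x \<in> C k"
      by (auto simp: C_def intro!: exI[of _ k])
    then have K: "x \<in> C K" "\<And>l. l < K \<Longrightarrow> x \<notin> C l"
      unfolding K_def by (auto intro: LeastI_ex dest: not_less_Least)
    \<comment> \<open>Only indices up to \<open>K\<close> matter, so finitely many eventual
      equalities are combined. Taking \<open>m > K\<close> as well ensures that the term at
      \<open>K\<close> occurs in the sum.\<close>
    have "\<forall>\<^sub>F m in sequentially. \<forall>l\<in>{..K}. u l m x = indicator (C l) x"
      using u(2)[OF x] by (intro eventually_ball_finite) auto
    then have "\<forall>\<^sub>F m in sequentially. h m x = c K"
      using eventually_gt_at_top[of K]
    proof eventually_elim
      case (elim m)
      have uK: "u K m x = 1" and ul: "\<And>l. l < K \<Longrightarrow> u l m x = 0"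
        using elim(1) K by auto
      \<comment> \<open>Below \<open>K\<close> the factor \<open>u k m x\<close> is 0, above
        \<open>K\<close> the product contains \<open>1 - u K m x = 0\<close>, and at
        \<open>K\<close> all factors but \<open>c K\<close> are 1.\<close>
      have "c k * (u k m x * (\<Prod>l<k. 1 - u l m x)) = (if k = K then c K else 0)" for k
      proof (cases k K rule: linorder_cases)
        case greater
        then have "(\<Prod>l<k. 1 - u l m x) = 0"
          using uK by (intro prod_zero) auto
        then show ?thesis using greater by simp
      qed (simp_all add: uK ul)
      then show ?case
        using elim(2) by (simp add: h_def)
    qed
    then show ?thesis using inP K(1) by blast
  qed
  ultimately show thesis by (rule that)
qed

text \<open>The uniform approximations at scales \<open>2\<^sup>-\<^sup>N\<close> are glued by clamping consecutive increments,
  which is harmless in the limit; the diagonal sequence then converges pointwise.\<close>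

lemma approximable_uniform_limit:
  assumes approx: "\<And>e :: real. 0 < e \<Longrightarrow> \<exists>h :: nat \<Rightarrow> 'a \<Rightarrow> real. range h \<subseteq> A \<and>
      (\<forall>x\<in>S. \<exists>c. \<bar>g x - c\<bar> < e \<and> (\<forall>\<^sub>F m in sequentially. h m x = c))"
  obtains H :: "nat \<Rightarrow> 'a \<Rightarrow> real" where "range H \<subseteq> A" "\<And>x. x \<in> S \<Longrightarrow> (\<lambda>m. H m x) \<longlonglongrightarrow> g x"
proof -
  define \<epsilon> :: "nat \<Rightarrow> real" where "\<epsilon> N = (1 / 2) ^ N" for N
  have \<epsilon>: "0 < \<epsilon> N" "\<epsilon> (Suc N) = \<epsilon> N / 2" "\<epsilon> N \<in> \<rat>" for N
    by (simp_all add: \<epsilon>_def)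
  have "\<forall>N. \<exists>h :: nat \<Rightarrow> 'a \<Rightarrow> real. range h \<subseteq> A \<and>
      (\<forall>x\<in>S. \<exists>c. \<bar>g x - c\<bar> < \<epsilon> N \<and> (\<forall>\<^sub>F m in sequentially. h m x = c))"
    using approx \<epsilon>(1) by blast
  from choice[OF this] obtain h :: "nat \<Rightarrow> nat \<Rightarrow> 'a \<Rightarrow> real" where h: "\<And>N. range (h N) \<subseteq> A"
    "\<And>N x. x \<in> S \<Longrightarrow> \<exists>c. \<bar>g x - c\<bar> < \<epsilon> N \<and> (\<forall>\<^sub>F m in sequentially. h N m x = c)"
    by blast
  \<comment> \<open>Clamping bounds each increment uniformly in \<open>m\<close> and
    \<open>x\<close>, also for those \<open>m\<close> at which \<open>h\<close> has not yet
    stabilised.\<close>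
  define p where "p = rec_nat (h 0)
    (\<lambda>N r m x. r m x + max (0 - 2 * \<epsilon> N) (min (2 * \<epsilon> N) (h (Suc N) m x - r m x)))"
  have p0: "p 0 = h 0" and pSuc: "p (Suc N) m =
      (\<lambda>x. p N m x + max (0 - 2 * \<epsilon> N) (min (2 * \<epsilon> N) (h (Suc N) m x - p N m x)))" for N m
    by (simp_all add: p_def)
  have pA: "p N m \<in> A" for N m
  proof (induction N)
    case 0
    then show ?case using h(1) by (auto simp: p0)
  next
    case (Suc N)
    have "h (Suc N) m \<in> A" using h(1) by blast
    then show ?case
      unfolding pSuc using Suc \<epsilon>(3)
      by (intro add max min diff const Rats_diff Rats_mult) auto
  qed
  have step: "\<bar>p (Suc N) m x - p N m x\<bar> \<le> 2 * \<epsilon> N" for N m x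
    using \<epsilon>(1)[of N] by (simp add: pSuc abs_le_iff)
  \<comment> \<open>Telescoping: the increments from \<open>N\<close> to \<open>N + k\<close> are
    bounded by \<open>2 * \<epsilon> j\<close>, and this geometric sum is the right-hand
    side.\<close>
  have tail: "\<bar>p (N + k) m x - p N m x\<bar> \<le> 4 * \<epsilon> N - 4 * \<epsilon> (N + k)" for N k m x
  proof (induction k)
    case (Suc k)
    then show ?case
      using step[of "N + k" m x] \<epsilon>(2)[of "N + k"] by simp
  qed simp
  have stable: "\<exists>c. \<bar>g x - c\<bar> < \<epsilon> N \<and> (\<forall>\<^sub>F m in sequentially. p N m x = c)" if x: "x \<in> S" for N x
  proof (induction N)
    case 0
    show ?case using h(2)[OF x, of 0] by (simp add: p0)
  next
    case (Suc N)
    then obtain c where c: "\<bar>g x - c\<bar> < \<epsilon> N" "\<forall>\<^sub>F m in sequentially. p N m x = c" by blast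
    obtain d where d: "\<bar>g x - d\<bar> < \<epsilon> (Suc N)" "\<forall>\<^sub>F m in sequentially. h (Suc N) m x = d"
      using h(2)[OF x] by blast
    \<comment> \<open>Both values are close to \<open>g x\<close>, within
      \<open>\<epsilon> N\<close> and half of it, so for large \<open>m\<close> the clamp is
      inactive and \<open>p (Suc N) m x\<close> equals \<open>d\<close>.\<close>
    have "\<bar>d - c\<bar> \<le> 2 * \<epsilon> N"
      using c(1) d(1) \<epsilon>(1,2)[of N] by linarith
    then have "\<forall>\<^sub>F m in sequentially. p (Suc N) m x = d"
      using eventually_conj[OF c(2) d(2)] by (auto elim!: eventually_mono simp: pSuc)
    then show ?case using d(1) by blast
  qed
  have "(\<lambda>m. p m m x) \<longlonglongrightarrow> g x" if x: "x \<in> S" for x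
  proof (rule tendstoI)
    fix e :: real assume "0 < e"
    \<comment> \<open>Of the 5 parts, one bounds the distance from \<open>c\<close> to
      \<open>g x\<close> and four bound the tail beyond level \<open>N\<close>.\<close>
    then obtain N where "(1 / 2 :: real) ^ N < e / 5"
      using real_arch_pow_inv[of "e / 5" "1 / 2"] by auto
    then have N: "5 * \<epsilon> N < e" by (simp add: \<epsilon>_def)
    obtain c where c: "\<bar>g x - c\<bar> < \<epsilon> N" "\<forall>\<^sub>F m in sequentially. p N m x = c"
      using stable[OF x] by blast
    from c(2) eventually_ge_at_top[of N]
    show "\<forall>\<^sub>F m in sequentially. dist (p m m x) (g x) < e"
    proof eventually_elim
      case (elim m)
      have "\<bar>p m m x - p N m x\<bar> \<le> 4 * \<epsilon> N"
        using tail[where N = N and k = "m - N" and m = m and x = x] elim(2) \<epsilon>(1)[of m] by simp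
      then show ?case
        using elim(1) c(1) N by (simp add: dist_real_def)
    qed
  qed
  then show thesis
    using pA that[of "\<lambda>m. p m m"] by blast
qed

end

section \<open>From a Velichko map to a countable sequentially dense set\<close>

lemma velichko_map_imp_sequentially_separable_Cp:
  assumes "velichko_map X Y f"
  shows "sequentially_separable_space (Cp X)"
proof -
  let ?S = "topspace X" and ?T = "mtopology_of Y"
  have sep: "separable_space ?T" and f: "continuous_map X ?T f"
    and bij: "bij_betw f ?S (mspace Y)"
    and fs: "\<And>U. cozero_in X U \<Longrightarrow> fsigma_in ?T (f ` U)"
    using assms by (auto simp: velichko_map_def)
  have fY: "f x \<in> mspace Y" if "x \<in> ?S" for x
    using bij that by (auto simp: bij_betw_def)
  interpret Y: Metric_space "mspace Y" "mdist Y"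
    by (rule Metric_space_mspace_mdist)
  obtain D where D: "countable D" "D \<subseteq> mspace Y" "?T closure_of D = mspace Y"
    using sep by (auto simp: separable_space_def)
  define G where "G = (\<lambda>d x. mdist Y d (f x)) ` D \<union> (\<lambda>q _. q) ` \<rat>"
  define OPS :: "(('a \<Rightarrow> real) \<Rightarrow> ('a \<Rightarrow> real) \<Rightarrow> 'a \<Rightarrow> real) set" where
    "OPS = {\<lambda>u v x. u x + v x, \<lambda>u v x. u x * v x, \<lambda>u v x. max (u x) (v x)}"
  obtain A0 where A0: "countable A0" "G \<subseteq> A0"
    "\<And>op a b. op \<in> OPS \<Longrightarrow> a \<in> A0 \<Longrightarrow> b \<in> A0 \<Longrightarrow> op a b \<in> A0"
  proof (rule countable_closure_under_binary_operations)
    show "countable G"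
      unfolding G_def using D(1) countable_rat by (intro countable_Un countable_image)
    show "countable OPS"
      by (simp add: OPS_def)
  qed blast
  \<comment> \<open>Continuous functions are closed under the same operations, so intersecting with
    them preserves the algebra and replaces an induction over the construction of
    \<open>A0\<close>.\<close>
  define A where "A = A0 \<inter> {u. continuous_map X euclideanreal u}"
  have op_in: "(\<lambda>x. u x + v x) \<in> A0" "(\<lambda>x. u x * v x) \<in> A0" "(\<lambda>x. max (u x) (v x)) \<in> A0"
    if "u \<in> A0" "v \<in> A0" for u v
    by (rule A0(3)[OF _ that, of "\<lambda>u v x. u x + v x"]
             A0(3)[OF _ that, of "\<lambda>u v x. u x * v x"]
             A0(3)[OF _ that, of "\<lambda>u v x. max (u x) (v x)"], simp add: OPS_def)+
  interpret rational_lattice_algebra A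
  proof
    fix q :: real assume "q \<in> \<rat>"
    then show "(\<lambda>_. q) \<in> A"
      using A0(2) by (auto simp: A_def G_def)
  qed (auto simp: A_def op_in intro!: continuous_intros)
  have distA: "(\<lambda>x. mdist Y d (f x)) \<in> A" if "d \<in> D" for d
    using A0(2) D(2) that f by (auto simp: A_def G_def intro!: continuous_map_mdist)
  have closed_approx: "indicator_approximable ?S {x \<in> ?S. f x \<in> K}" if K: "closedin ?T K" for K
  proof -
    \<comment> \<open>These are bumps on balls with centre in \<open>D\<close> and rational radius
      that miss \<open>K\<close>. Such balls cover the complement of \<open>K\<close>, so
      \<open>K\<close> pulls back to the common zero set of \<open>F\<close>.\<close>
    define F where "F = (\<lambda>(d, r) x. max 0 (r - mdist Y d (f x))) `
      {(d, r). d \<in> D \<and> r \<in> \<rat> \<and> mball_of Y d r \<inter> K = {}}"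
    have "countable {(d, r). d \<in> D \<and> r \<in> \<rat> \<and> mball_of Y d r \<inter> K = {}}"
      by (rule countable_subset[of _ "D \<times> \<rat>"]) (use D(1) countable_rat in auto)
    then have "countable F"
      by (simp add: F_def)
    moreover have "F \<subseteq> A"
      by (auto simp: F_def intro!: max diff const distA)
    moreover have "0 \<le> w x" if "w \<in> F" for w x
      using that by (auto simp: F_def)
    moreover have "w x = 0" if "w \<in> F" "x \<in> ?S \<inter> {x \<in> ?S. f x \<in> K}" for w x
      using that D(2) fY by (force simp: F_def disjoint_iff)
    moreover have "\<exists>w\<in>F. 0 < w x" if x: "x \<in> ?S - {x \<in> ?S. f x \<in> K}" for x
    proof -
      have y: "f x \<in> mspace Y - K" using x fY by auto
      have "openin ?T (mspace Y - K)"
        using K by (metis openin_diff openin_topspace topspace_mtopology_of)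
      then obtain r where r: "0 < r" "mball_of Y (f x) r \<subseteq> mspace Y - K"
        using y unfolding mtopology_of_def mball_of_def Y.openin_mtopology by blast
      \<comment> \<open>Radius below \<open>r / 2\<close>: a ball of radius \<open>q\<close> around
        a centre within \<open>q\<close> of \<open>f x\<close> stays inside the ball of radius
        \<open>r\<close> around \<open>f x\<close>.\<close>
      obtain q where q: "q \<in> \<rat>" "0 < q" "q < r / 2"
        using Rats_dense_in_real[of 0 "r / 2"] r(1) by auto
      have "f x \<in> ?T closure_of D" using D(3) y by simp
      then obtain d where d: "d \<in> D" "mdist Y (f x) d < q"
        using q(2) unfolding mtopology_of_def Y.metric_closure_of Y.in_mball by blast
      have "mball_of Y d q \<subseteq> mball_of Y (f x) r"
      proof
        fix z assume z: "z \<in> mball_of Y d q"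
        then have "mdist Y (f x) z \<le> mdist Y (f x) d + mdist Y d z"
          using y by (intro mdist_triangle) auto
        then show "z \<in> mball_of Y (f x) r"
          using z d q y by auto
      qed
      then have "mball_of Y d q \<inter> K = {}" using r by blast
      then have "(\<lambda>x. max 0 (q - mdist Y d (f x))) \<in> F"
        using d q by (auto simp: F_def)
      moreover have "0 < max 0 (q - mdist Y d (f x))"
        using d(2) by (simp add: mdist_commute)
      ultimately show ?thesis by (intro bexI)
    qed
    ultimately show ?thesis
      by (intro indicator_approximable_zero_set[of F]) blast+
  qed
  have limit: "\<exists>H. range H \<subseteq> A \<and> (\<forall>x\<in>?S. (\<lambda>m. H m x) \<longlonglongrightarrow> g x)"
    if g: "continuous_map X euclideanreal g" for g
  proof -
    have uniform: "\<exists>h. range h \<subseteq> A \<and> (\<forall>x\<in>?S. \<exists>c. \<bar>g x - c\<bar> < e \<and> (\<forall>\<^sub>F m in sequentially. h m x = c))"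
      if "0 < e" for e :: real
    proof -
      define U where "U q = {x \<in> ?S. \<bar>g x - q\<bar> < e}" for q
      have coz: "cozero_in X (U q)" for q
        unfolding cozero_in_def
      proof (intro exI conjI)
        show "continuous_map X euclideanreal (\<lambda>x. max 0 (e - \<bar>g x - q\<bar>))"
          using g by (intro continuous_intros) auto
        show "U q = {x \<in> ?S. max 0 (e - \<bar>g x - q\<bar>) \<noteq> 0}"
          by (auto simp: U_def max_def)
      qed
      have "\<forall>q. \<exists>\<C>. countable \<C> \<and> \<C> \<subseteq> Collect (closedin ?T) \<and> \<Union>\<C> = f ` U q"
        proof
        show "\<exists>\<C>. countable \<C> \<and> \<C> \<subseteq> Collect (closedin ?T) \<and> \<Union>\<C> = f ` U q" for q
          using fs[OF coz[of q]] unfolding fsigma_in_def union_of_def .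
      qed
      from choice[OF this] obtain \<C> where
        "\<forall>q. countable (\<C> q) \<and> \<C> q \<subseteq> Collect (closedin ?T) \<and> \<Union>(\<C> q) = f ` U q" ..
      then have \<C>: "\<And>q. countable (\<C> q)" "\<And>q K. K \<in> \<C> q \<Longrightarrow> closedin ?T K"
        "\<And>q. \<Union>(\<C> q) = f ` U q"
        by (simp_all only: subset_iff mem_Collect_eq)
      define P where "P = (\<lambda>(q, K). ({x \<in> ?S. f x \<in> K}, q)) ` (SIGMA q:\<rat>. \<C> q)"
      have P: "(\<exists>K. closedin ?T K \<and> C = {x \<in> ?S. f x \<in> K}) \<and> q \<in> \<rat> \<and> C \<subseteq> U q"
        if Cq: "(C, q) \<in> P" for C q
      proof -
        obtain K where K: "K \<in> \<C> q" "C = {x \<in> ?S. f x \<in> K}" "q \<in> \<rat>"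
          using Cq by (auto simp: P_def)
        have "C \<subseteq> U q"
        proof
          fix x assume x: "x \<in> C"
          then have "f x \<in> \<Union>(\<C> q)" using K by blast
          then have "f x \<in> f ` U q" by (simp only: \<C>(3))
          \<comment> \<open>Injectivity of \<open>f\<close> brings membership in the image of
            \<open>U q\<close> back to \<open>U q\<close>.\<close>
          then obtain z where "z \<in> U q" "f x = f z" by blast
          moreover from this have "x = z"
            using x K(2) by (intro inj_onD[OF bij_betw_imp_inj_on[OF bij]]) (auto simp: U_def)
          ultimately show "x \<in> U q" by simp
        qed
        then show ?thesis using K(2,3) \<C>(2)[OF K(1)] by blast
      qed
      obtain h where h: "range h \<subseteq> A"
        "\<And>x. x \<in> ?S \<Longrightarrow> \<exists>(C, q)\<in>P. x \<in> C \<and> (\<forall>\<^sub>F m in sequentially. h m x = q)"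
      proof (rule approximable_selection)
        show "countable P"
          unfolding P_def by (intro countable_image countable_SIGMA countable_rat \<C>(1))
        show "q \<in> \<rat> \<and> indicator_approximable ?S C" if "(C, q) \<in> P" for C q
          using P[OF that] closed_approx by blast
        show "\<exists>(C, q)\<in>P. x \<in> C" if x: "x \<in> ?S" for x
        proof -
          obtain q where "q \<in> \<rat>" "g x - e < q" "q < g x"
            using Rats_dense_in_real[of "g x - e" "g x"] \<open>0 < e\<close> by auto
          moreover from this have "f x \<in> f ` U q"
            using x by (auto simp: U_def)
          then have "f x \<in> \<Union>(\<C> q)" by (simp only: \<C>(3))
          then obtain K where "K \<in> \<C> q" "f x \<in> K" by blast
          ultimately have "({x \<in> ?S. f x \<in> K}, q) \<in> P" "x \<in> {x \<in> ?S. f x \<in> K}"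
            using x by (auto simp: P_def)
          then show ?thesis
            by (intro bexI[of _ "({x \<in> ?S. f x \<in> K}, q)"]) simp_all
        qed
      qed (rule that)
      have "\<exists>c. \<bar>g x - c\<bar> < e \<and> (\<forall>\<^sub>F m in sequentially. h m x = c)" if x: "x \<in> ?S" for x
      proof -
        obtain C q where "(C, q) \<in> P" "x \<in> C" "\<forall>\<^sub>F m in sequentially. h m x = q"
          using h(2)[OF x] by blast
        moreover from this have "\<bar>g x - q\<bar> < e"
          using P[of C q] by (auto simp: U_def)
        ultimately show ?thesis by blast
      qed
      then show ?thesis
        using h(1) by (intro exI[of _ h] conjI ballI)
    qed
    show ?thesis
    proof (rule approximable_uniform_limit[OF uniform])
      fix H assume "range H \<subseteq> A" "\<And>x. x \<in> ?S \<Longrightarrow> (\<lambda>m. H m x) \<longlonglongrightarrow> g x"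
      then show ?thesis
        by (intro exI[of _ H] conjI ballI)
    qed
  qed
  \<comment> \<open>Members of \<open>A\<close> are defined on the whole type; restricting them
    gives the extensional representatives.\<close>
  define B where "B = (\<lambda>u. restrict u ?S) ` A"
  have B: "B \<subseteq> topspace (Cp X)"
    unfolding B_def A_def by (intro image_subsetI restrict_in_Cp) simp
  have "g \<in> Cp X seq_closure_of B" if g: "g \<in> topspace (Cp X)" for g
  proof -
    obtain H where H: "range H \<subseteq> A" "\<forall>x\<in>?S. (\<lambda>m. H m x) \<longlonglongrightarrow> g x"
      using limit[of g] g unfolding topspace_Cp by blast
    then have "range (\<lambda>m. restrict (H m) ?S) \<subseteq> B"
      by (auto simp: B_def)
    moreover from this have "limitin (Cp X) (\<lambda>m. restrict (H m) ?S) g sequentially"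
      using H(2) g B by (intro limitin_CpI) auto
    ultimately show ?thesis
      unfolding seq_closure_of_def
      by (intro CollectI exI[of _ "\<lambda>m. restrict (H m) ?S"] conjI)
  qed
  then have "Cp X seq_closure_of B = topspace (Cp X)"
    by (intro subset_antisym seq_closure_of_subset subsetI)
  moreover have "countable B"
    using A0(1) by (simp add: B_def A_def)
  ultimately show ?thesis
    using B unfolding sequentially_separable_space_def by blast
qed

theorem theorem2p3:
  fixes X :: "'a topology"
  assumes "tychonoff_space X"
    and "has_coarser_separable_metrizable X"
  shows "(sequentially_separable_space (Cp X) \<longleftrightarrow> sigma_separable_space (Cp X))
       \<and> (sigma_separable_space (Cp X) \<longleftrightarrow> velichko_property X)"
proof (intro conjI)
  show sigma: "sequentially_separable_space (Cp X) \<longleftrightarrow> sigma_separable_space (Cp X)"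
    by (rule iffI[OF sequentially_imp_sigma_separable_Cp sigma_imp_sequentially_separable])
  show "sigma_separable_space (Cp X) \<longleftrightarrow> velichko_property X"
    unfolding sigma[symmetric]
  proof
    show "velichko_property X" if "sequentially_separable_space (Cp X)"
      using assms(1) that by (rule sequentially_separable_Cp_imp_velichko)
    show "sequentially_separable_space (Cp X)" if "velichko_property X"
      using that unfolding velichko_property_def
      by (elim exE) (rule velichko_map_imp_sequentially_separable_Cp)
  qed
qed

end
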